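(* Let $\tau\in\mathbb{C}$ with $\mathrm{Im}(\tau)>0$, $q=e^{2\pi i\tau}$, and let $k$ be a non-negative integer. For $u,v\in\mathbb{C}$ with $u,v\notin\mathbb{Z}+\mathbb{Z}\tau$, $$\mu(u,v;-k)=-i\,q^{-\frac18}H_k(\cos\pi(u-v)\mid q),$$ where $H_k$ is the continuous $q$-Hermite polynomial of degree $k$, $$H_k(\cos\pi(u-v)\mid q)=\sum_{l=0}^k\frac{(q)_k}{(q)_l(q)_{k-l}}e^{\pi i(k-2l)(u-v)}.$$
   Context: Powers: $q^s:=e^{2\pi is\tau}$. $(x)_\infty=(x;q)_\infty=\prod_{j\ge0}(1-xq^j)$, $(x)_n=(x)_\infty/(q^nx)_\infty$. $\vartheta_{11}(u)=\sum_{n\in\mathbb{Z}}e^{2\pi i(n+\frac12)(u+\frac12)+\pi i(n+\frac12)^2\tau}$. Generalized $\mu$-function: for $\alpha,u,v\in\mathbb{C}$ with $u-\alpha\tau,v\notin\mathbb{Z}+\mathbb{Z}\tau$, $$\mu(u,v;\alpha)=\frac{e^{\pi i\alpha(u-v)}}{\vartheta_{11}(v)}\sum_{n\in\mathbb{Z}}(-1)^ne^{2\pi i(n+\frac12)v}q^{\frac{n(n+1)}2}\frac{(e^{2\pi iu}q^{n+1})_\infty}{(e^{2\pi iu}q^{n-\alpha+1})_\infty}.$$ *)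

theory Defs
  imports "HOL-Analysis.Analysis" "HOL-Computational_Algebra.Polynomial"
begin

text \<open>For non-integral \<open>s\<close> the power of \<open>q\<close> with exponent \<open>s\<close> depends on \<open>\<tau>\<close>, not on \<open>q\<close> alone.\<close>

definition qpow :: "complex \<Rightarrow> complex \<Rightarrow> complex" where
  "qpow \<tau> s = exp (2 * of_real pi * \<i> * s * \<tau>)"

definition qpoch_inf :: "complex \<Rightarrow> complex \<Rightarrow> complex" where
  "qpoch_inf q x = (\<Prod>j. 1 - x * q ^ j)"

definition qpoch :: "complex \<Rightarrow> complex \<Rightarrow> nat \<Rightarrow> complex" where
  "qpoch q x n = qpoch_inf q x / qpoch_inf q (q ^ n * x)"

definition period_lattice :: "complex \<Rightarrow> complex set" where
  "period_lattice \<tau> = {of_int m + of_int n * \<tau> | m n. True}"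

definition theta11 :: "complex \<Rightarrow> complex \<Rightarrow> complex" where
  "theta11 \<tau> u = (\<Sum>\<^sub>\<infinity>n\<in>(UNIV :: int set).
     exp (2 * of_real pi * \<i> * (of_int n + 1/2) * (u + 1/2)
          + of_real pi * \<i> * (of_int n + 1/2)\<^sup>2 * \<tau>))"

text \<open>Meaningful for \<open>Im \<tau> > 0\<close> and \<open>u - \<alpha>\<tau>, v \<notin> \<int> + \<int>\<tau>\<close>.\<close>

definition gen_mu :: "complex \<Rightarrow> complex \<Rightarrow> complex \<Rightarrow> complex \<Rightarrow> complex" where
  "gen_mu \<tau> u v \<alpha> =
     exp (of_real pi * \<i> * \<alpha> * (u - v)) / theta11 \<tau> v *
     (\<Sum>\<^sub>\<infinity>n\<in>(UNIV :: int set).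
        (-1) powi n * exp (2 * of_real pi * \<i> * (of_int n + 1/2) * v)
        * qpow \<tau> (of_int n * (of_int n + 1) / 2)
        * (qpoch_inf (qpow \<tau> 1) (exp (2 * of_real pi * \<i> * u) * qpow \<tau> (of_int n + 1))
           / qpoch_inf (qpow \<tau> 1) (exp (2 * of_real pi * \<i> * u) * qpow \<tau> (of_int n - \<alpha> + 1))))"

definition qhermite_sum :: "complex \<Rightarrow> nat \<Rightarrow> complex \<Rightarrow> complex" where
  "qhermite_sum q k \<theta> =
     (\<Sum>l=0..k. qpoch q q k / (qpoch q q l * qpoch q q (k - l))
                * exp (\<i> * (of_nat k - 2 * of_nat l) * \<theta>))"

text \<open>The continuous \<open>q\<close>-Hermite polynomial \<open>H\<^sub>k(x | q)\<close> as a polynomial in \<open>x\<close>, specified by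
  its values at \<open>x = cos \<theta>\<close>; \<open>qhermite_ex1\<close> below shows that the description is proper.\<close>

definition qhermite :: "complex \<Rightarrow> nat \<Rightarrow> complex poly" where
  "qhermite q k = (THE p. \<forall>\<theta>. poly p (cos \<theta>) = qhermite_sum q k \<theta>)"

lemma cos_multiple_poly:
  "\<exists>p :: complex poly. \<forall>\<theta>. poly p (cos \<theta>) = cos (of_nat n * \<theta>)"
proof (induction n rule: less_induct)
  case (less n)
  consider "n = 0" | "n = 1" | m where "n = Suc (Suc m)"
    by (metis One_nat_def not0_implies_Suc)
  then show ?case
  proof cases
    case 1
    then show ?thesis by (intro exI[of _ 1]) simp
  next
    case 2
    then show ?thesis by (intro exI[of _ "[:0, 1:]"]) simp
  next
    case 3
    obtain p where p: "\<And>\<theta> :: complex. poly p (cos \<theta>) = cos (of_nat m * \<theta>)"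
      using less[of m] 3 by (metis lessI less_Suc_eq)
    obtain r where r: "\<And>\<theta> :: complex. poly r (cos \<theta>) = cos (of_nat (Suc m) * \<theta>)"
      using less[of "Suc m"] 3 by blast
    have "poly ([:0, 2:] * r - p) (cos \<theta>) = cos (of_nat n * \<theta>)" for \<theta> :: complex
    proof -
      define x where "x = of_nat (Suc m) * \<theta>"
      have "of_nat n * \<theta> = x + \<theta>" "of_nat m * \<theta> = x - \<theta>"
        using 3 by (simp_all add: x_def algebra_simps)
      then show ?thesis
        using p[of \<theta>] r[of \<theta>, folded x_def] by (simp add: cos_add cos_diff)
    qed
    then show ?thesis by blast
  qed
qed

lemma qhermite_sum_symmetric:
  "qhermite_sum q k \<theta> =
     (\<Sum>l=0..k. qpoch q q k / (qpoch q q l * qpoch q q (k - l))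
                * cos ((of_nat k - 2 * of_nat l) * \<theta>))"
proof -
  let ?c = "\<lambda>l. qpoch q q k / (qpoch q q l * qpoch q q (k - l))"
  let ?a = "\<lambda>l. (of_nat k - 2 * of_nat l :: complex) * \<theta>"
  have "qhermite_sum q k \<theta> = (\<Sum>l=0..k. ?c l * exp (\<i> * ?a l))"
    by (simp add: qhermite_sum_def mult.assoc)
  moreover have "\<dots> = (\<Sum>l=0..k. ?c (k - l) * exp (\<i> * ?a (k - l)))"
    using sum.atLeastAtMost_rev[of "\<lambda>l. ?c l * exp (\<i> * ?a l)" 0 k] by simp
  moreover have "\<dots> = (\<Sum>l=0..k. ?c l * exp (- (\<i> * ?a l)))"
    by (intro sum.cong refl) (simp add: of_nat_diff algebra_simps)
  ultimately have "2 * qhermite_sum q k \<theta> =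
      (\<Sum>l=0..k. ?c l * exp (\<i> * ?a l)) + (\<Sum>l=0..k. ?c l * exp (- (\<i> * ?a l)))"
    by simp
  also have "\<dots> = (\<Sum>l=0..k. 2 * (?c l * cos (?a l)))"
    unfolding sum.distrib[symmetric] cos_exp_eq
    by (intro sum.cong refl) (simp only: distrib_left[symmetric], simp)
  finally show ?thesis
    by (subst (asm) sum_distrib_left[symmetric]) simp
qed

lemma qhermite_ex1: "\<exists>!p. \<forall>\<theta>. poly p (cos \<theta>) = qhermite_sum q k \<theta>"
proof -
  have "\<exists>p :: complex poly. \<forall>\<theta>. poly p (cos \<theta>) = cos ((of_nat k - 2 * of_nat l) * \<theta>)"
    for l :: nat
  proof (cases "2 * l \<le> k")
    case True
    then show ?thesis
      using cos_multiple_poly[of "k - 2 * l"] by (simp add: of_nat_diff)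
  next
    case False
    then have "of_nat (2 * l - k) = - (of_nat k - 2 * of_nat l :: complex)"
      by (simp add: of_nat_diff)
    then show ?thesis
      using cos_multiple_poly[of "2 * l - k"] by (metis cos_minus mult_minus_left)
  qed
  then obtain P where P: "\<And>l (\<theta> :: complex). poly (P l) (cos \<theta>) = cos ((of_nat k - 2 * of_nat l) * \<theta>)"
    by metis
  show ?thesis
  proof (rule ex_ex1I)
    show "\<exists>p. \<forall>\<theta>. poly p (cos \<theta>) = qhermite_sum q k \<theta>"
      by (rule exI[of _ "\<Sum>l=0..k. smult (qpoch q q k / (qpoch q q l * qpoch q q (k - l))) (P l)"])
        (simp add: poly_sum P qhermite_sum_symmetric)
  next
    fix p r
    assume "\<forall>\<theta>. poly p (cos \<theta>) = qhermite_sum q k \<theta>"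
      and "\<forall>\<theta>. poly r (cos \<theta>) = qhermite_sum q k \<theta>"
    then have "poly p x = poly r x" for x
      by (metis cos_Arccos)
    then show "p = r"
      by (simp add: poly_eq_poly_eq_iff[symmetric] fun_eq_iff)
  qed
qed

end

theory Submission
  imports Defs
begin

text \<open>Write \<open>x\<close> and \<open>z\<close> for the exponentials of \<open>2 * pi * \<i> * u\<close> and \<open>2 * pi * \<i> * v\<close>, and
  \<open>[k, l]\<close> for the Gaussian binomial coefficient. For \<open>\<alpha> = - k\<close> the quotient of infinite products in
  the \<open>n\<close>-th term of \<open>gen_mu\<close> collapses to the polynomial \<open>(x q^(n+1); q)_k\<close>. The \<open>q\<close>-binomial
  theorem expands this polynomial in powers of \<open>q^n\<close>. The weights of the bilateral series are
  \<open>(-z)^n q^(n (n + 1) / 2)\<close>, whose quadratic exponent absorbs the factor \<open>q^(n l)\<close> by the shift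
  \<open>n \<mapsto> n + l\<close> (\<open>theta_term_shift\<close>). Hence the \<open>l\<close>-th power contributes
  \<open>[k, l] (x / z)^l\<close> times one and the same theta series, and the whole series equals
  that theta series times the sum of all \<open>[k, l] (x / z)^l\<close> (\<open>infsum_theta_term_qprod\<close>). The theta
  series is \<open>theta11 \<tau> v\<close> up to the elementary factor \<open>\<i> q^(1/8) exp (pi * \<i> * v)\<close>, so it cancels
  against the denominator of \<open>gen_mu\<close>. What remains, multiplied by the prefactor
  \<open>exp (- pi * \<i> * k * (u - v))\<close>, is the \<open>q\<close>-Hermite sum read backwards.\<close>

text \<open>The cancellation requires that \<open>theta11 \<tau> v\<close> does not vanish for \<open>v\<close> outside the period lattice.
  This is read off the Jacobi triple product (\<open>jacobi_triple_product\<close>), whose factors visibly vanish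
  only at lattice points. The triple product in turn is the limit \<open>N \<longlonglongrightarrow> \<infinity>\<close> of the
  \<open>q\<close>-binomial theorem for the exponent \<open>2 N\<close>, recentred so that the summation index runs
  from \<open>- N\<close> to \<open>N\<close>; Tannery's theorem justifies the passage to the limit.\<close>

section \<open>Finite \<open>q\<close>-products and the \<open>q\<close>-binomial theorem\<close>

definition qprod :: "complex \<Rightarrow> complex \<Rightarrow> nat \<Rightarrow> complex" where
  "qprod q x n = (\<Prod>j<n. 1 - x * q ^ j)"

text \<open>Defined by Pascal's recurrence, because this is what the induction for the \<open>q\<close>-binomial theorem
  consumes, and because the coefficients with \<open>l > n\<close> are then zero.\<close>

fun qbinom :: "complex \<Rightarrow> nat \<Rightarrow> nat \<Rightarrow> complex" where
  "qbinom q n 0 = 1"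
| "qbinom q 0 (Suc l) = 0"
| "qbinom q (Suc n) (Suc l) = qbinom q n (Suc l) + q ^ (n - l) * qbinom q n l"

lemma qbinom_eq_0: "n < l \<Longrightarrow> qbinom q n l = 0"
  by (induction q n l rule: qbinom.induct) auto

lemma qbinom_self [simp]: "qbinom q n n = 1"
  by (induction n) (auto simp: qbinom_eq_0)

lemma qprod_0 [simp]: "qprod q x 0 = 1"
  by (simp add: qprod_def)

lemma qprod_Suc: "qprod q x (Suc n) = qprod q x n * (1 - x * q ^ n)"
  by (simp add: qprod_def)

lemma qprod_add: "qprod q x (m + n) = qprod q x m * qprod q (q ^ m * x) n"
  by (induction n) (auto simp: qprod_Suc power_add algebra_simps)

text \<open>Multiplied out, the quotient formula for Gaussian binomials becomes division-free, and the
  induction step is the identity \<open>(1 - q^(n - l)) + q^(n - l) (1 - q^(l + 1)) = 1 - q^(n + 1)\<close>.\<close>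

lemma qbinom_mult_qprod:
  "l \<le> n \<Longrightarrow> qbinom q n l * (qprod q q l * qprod q q (n - l)) = qprod q q n"
proof (induction q n l rule: qbinom.induct)
  case (3 q n l)
  show ?case
  proof (cases "l = n")
    case True
    then show ?thesis
      using 3 by (simp add: qprod_Suc qbinom_eq_0 algebra_simps)
  next
    case False
    then obtain d where d: "n = Suc (l + d)"
      using 3 by (metis Suc_le_mono le_neq_implies_less less_imp_Suc_add)
    have a: "qbinom q n (Suc l) * (qprod q q (Suc l) * qprod q q d) = qprod q q n"
      and b: "qbinom q n l * (qprod q q l * qprod q q (Suc d)) = qprod q q n"
      using 3 d by (simp_all add: Suc_diff_le)
    have "qbinom q (Suc n) (Suc l) * (qprod q q (Suc l) * qprod q q (Suc d))
      = qbinom q n (Suc l) * (qprod q q (Suc l) * qprod q q d) * (1 - q * q ^ d)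
        + q * q ^ d * (1 - q * q ^ l) * (qbinom q n l * (qprod q q l * qprod q q (Suc d)))"
      by (simp add: d qprod_Suc Suc_diff_le algebra_simps)
    also have "\<dots> = qprod q q (Suc n)"
      unfolding a b by (simp add: d qprod_Suc power_add algebra_simps)
    finally show ?thesis
      by (simp add: d)
  qed
qed auto

text \<open>Appending the factor \<open>1 - x q^n\<close> adds to the coefficient of \<open>(- x)^(l + 1)\<close> the coefficient of
  \<open>(- x)^l\<close> times \<open>q^n\<close>; after splitting \<open>q^n = q^(n - l) q^l\<close>, the second factor
  completes \<open>q ^ (l choose 2)\<close> to \<open>q ^ (Suc l choose 2)\<close> and the first is the Pascal weight.\<close>

theorem q_binomial_theorem:
  "qprod q x n = (\<Sum>l\<le>n. qbinom q n l * q ^ (l choose 2) * (- x) ^ l)"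
proof (induction n)
  case (Suc n)
  define t where "t l = qbinom q n l * q ^ (l choose 2) * (- x) ^ l" for l
  have step: "qbinom q (Suc n) (Suc l) * q ^ (Suc l choose 2) * (- x) ^ Suc l
      = t (Suc l) - x * q ^ n * t l" if "l \<le> n" for l
  proof -
    have "q ^ (n - l) * q ^ l = q ^ n"
      using that by (simp flip: power_add)
    then have "q ^ n * t l = q ^ (n - l) * q ^ l * t l"
      by simp
    then show ?thesis
      by (simp add: t_def numeral_2_eq_2 power_add algebra_simps)
  qed
  have "(\<Sum>l\<le>Suc n. qbinom q (Suc n) l * q ^ (l choose 2) * (- x) ^ l)
      = 1 + (\<Sum>l\<le>n. t (Suc l) - x * q ^ n * t l)"
    by (subst sum.atMost_Suc_shift) (simp add: step binomial_eq_0 del: power_Suc qbinom.simps(3))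
  also have "\<dots> = (t 0 + (\<Sum>l\<le>n. t (Suc l))) - x * q ^ n * (\<Sum>l\<le>n. t l)"
    by (simp add: sum_subtractf sum_distrib_left t_def binomial_eq_0)
  also have "t 0 + (\<Sum>l\<le>n. t (Suc l)) = (\<Sum>l\<le>n. t l)"
    by (subst sum.atMost_Suc_shift[symmetric]) (simp add: t_def qbinom_eq_0)
  finally show ?case
    using Suc.IH by (simp add: t_def qprod_Suc algebra_simps)
qed (simp add: binomial_eq_0)

section \<open>Infinite \<open>q\<close>-products\<close>

lemma convergent_qpoch_inf:
  fixes q x :: complex
  assumes "norm q < 1"
  shows "convergent_prod (\<lambda>j. 1 - x * q ^ j)"
proof -
  have "summable (\<lambda>j. norm (- (x * q ^ j)))"
    using assms by (simp add: norm_mult norm_power summable_mult summable_geometric)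
  then have "abs_convergent_prod (\<lambda>j. 1 + - (x * q ^ j))"
    by (intro summable_imp_abs_convergent_prod) simp
  then show ?thesis
    by (simp add: abs_convergent_prod_imp_convergent_prod)
qed

lemma qprod_tendsto_qpoch_inf:
  assumes "norm q < 1"
  shows "qprod q x \<longlonglongrightarrow> qpoch_inf q x"
proof -
  have "(\<lambda>n. \<Prod>j\<le>n. 1 - x * q ^ j) \<longlonglongrightarrow> qpoch_inf q x"
    unfolding qpoch_inf_def by (rule convergent_prod_LIMSEQ[OF convergent_qpoch_inf[OF assms]])
  then have "(\<lambda>n. qprod q x (Suc n)) \<longlonglongrightarrow> qpoch_inf q x"
    by (simp add: qprod_def lessThan_Suc_atMost)
  then show ?thesis
    by (rule LIMSEQ_imp_Suc)
qed

lemma qpoch_inf_nonzero: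
  assumes "norm q < 1" and "\<And>j. x * q ^ j \<noteq> 1"
  shows "qpoch_inf q x \<noteq> 0"
  unfolding qpoch_inf_def
  using prodinf_nonzero[OF convergent_qpoch_inf[OF assms(1)]] assms(2) by (metis eq_iff_diff_eq_0)

lemma qpoch_inf_split:
  assumes "norm q < 1"
  shows "qpoch_inf q x = qprod q x n * qpoch_inf q (q ^ n * x)"
proof -
  have "(\<lambda>m. qprod q x n * qprod q (q ^ n * x) m) = (\<lambda>m. qprod q x (m + n))"
    by (simp add: qprod_add[of q x n] add.commute[of _ n])
  moreover have "(\<lambda>m. qprod q x (m + n)) \<longlonglongrightarrow> qpoch_inf q x"
    by (rule LIMSEQ_ignore_initial_segment[OF qprod_tendsto_qpoch_inf[OF assms]])
  moreover have "(\<lambda>m. qprod q x n * qprod q (q ^ n * x) m)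
      \<longlonglongrightarrow> qprod q x n * qpoch_inf q (q ^ n * x)"
    by (intro tendsto_intros qprod_tendsto_qpoch_inf assms)
  ultimately show ?thesis
    by (metis LIMSEQ_unique)
qed

text \<open>If the infinite product in the denominator of \<open>qpoch\<close> vanishes, the quotient is \<open>0\<close> by convention
  and can differ from the finite product; the second assumption excludes this.\<close>

lemma qpoch_eq_qprod:
  assumes "norm q < 1" and "\<And>j. x * q ^ j \<noteq> 1"
  shows "qpoch q x n = qprod q x n"
proof -
  have "qpoch_inf q (q ^ n * x) \<noteq> 0"
    using assms(2)[of "n + _"] by (intro qpoch_inf_nonzero assms(1)) (simp add: power_add mult_ac)
  then show ?thesis
    using qpoch_inf_split[OF assms(1), of x n] by (simp add: qpoch_def)
qed

lemma q_power_neq_1: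
  fixes q :: complex
  assumes "norm q < 1"
  shows "q * q ^ j \<noteq> 1"
proof
  assume "q * q ^ j = 1"
  then have "norm q ^ Suc j = 1"
    by (metis norm_one norm_power power_Suc)
  then show False
    using power_less_one_iff[of "norm q" "Suc j"] assms by simp
qed

lemma qprod_q_nonzero:
  assumes "norm q < 1"
  shows "qprod q q n \<noteq> 0"
  using q_power_neq_1[OF assms] by (simp add: qprod_def)

lemma qbinom_eq_qpoch:
  assumes "norm q < 1" and "l \<le> n"
  shows "qbinom q n l = qpoch q q n / (qpoch q q l * qpoch q q (n - l))"
  using qbinom_mult_qprod[OF assms(2), of q] assms(1)
  by (simp add: qpoch_eq_qprod q_power_neq_1 qprod_q_nonzero field_simps)

section \<open>Theta series\<close>

text \<open>Triangular numbers on all integers, so that \<open>q powi tri n\<close> is an integral power of \<open>q\<close> and no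
  logarithm of \<open>q\<close> has to be chosen.\<close>

definition tri :: "int \<Rightarrow> int" where
  "tri n = n * (n + 1) div 2"

lemma two_tri: "2 * tri n = n * (n + 1)"
  by (simp add: tri_def)

lemma two_choose_two: "2 * int (l choose 2) = int l * (int l - 1)"
  by (induction l) (auto simp: numeral_2_eq_2 algebra_simps)

lemma tri_add_nat: "tri (n + int l) = tri n + (n + 1) * int l + int (l choose 2)"
proof -
  have "2 * tri (n + int l) = 2 * (tri n + (n + 1) * int l + int (l choose 2))"
    using two_tri[of n] two_tri[of "n + int l"] two_choose_two[of l] by (simp add: algebra_simps)
  then show ?thesis by simp
qed

definition theta_term :: "complex \<Rightarrow> complex \<Rightarrow> int \<Rightarrow> complex" where
  "theta_term q z n = (- z) powi n * q powi tri n"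

text \<open>The \<open>l\<close>-th term of the \<open>q\<close>-binomial expansion of \<open>(x q^(n+1); q)_k\<close>, without its Gaussian
  coefficient and multiplied by the theta weight at \<open>n\<close>, is a multiple of the theta weight at
  \<open>n + l\<close> by a factor independent of \<open>n\<close>. The reason is the polarisation identity \<open>tri_add_nat\<close> of
  the quadratic exponent.\<close>

lemma theta_term_shift:
  assumes "q \<noteq> 0" "z \<noteq> 0"
  shows "theta_term q z n * (q ^ (l choose 2) * (- (x * q powi (n + 1))) ^ l)
     = (x / z) ^ l * theta_term q z (n + int l)"
proof -
  have "q powi tri (n + int l) = q powi tri n * (q powi (n + 1)) ^ l * q ^ (l choose 2)"
    using assms by (simp add: tri_add_nat power_int_add power_int_mult)
  moreover have "(- z) powi (n + int l) = (- z) powi n * (- z) ^ l"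
    using assms by (simp add: power_int_add)
  moreover have "(- (x * q powi (n + 1))) ^ l = (- x) ^ l * (q powi (n + 1)) ^ l"
    by (metis mult_minus_left power_mult_distrib)
  moreover have "(x / z) ^ l * (- z) ^ l = (- x) ^ l"
    using assms by (simp flip: power_mult_distrib)
  ultimately show ?thesis
    by (simp add: theta_term_def)
qed

lemma summable_half_theta:
  fixes r t :: real
  assumes "0 \<le> r" "r < 1"
  shows "summable (\<lambda>n. t ^ n * r ^ (Suc n choose 2))"
proof -
  have "(\<lambda>n. \<bar>t\<bar> * r ^ Suc n) \<longlonglongrightarrow> \<bar>t\<bar> * 0"
    using assms by (intro tendsto_intros LIMSEQ_Suc LIMSEQ_realpow_zero) auto
  then have "eventually (\<lambda>n. \<bar>t\<bar> * r ^ Suc n < 1/2) sequentially"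
    by (rule order_tendstoD) simp
  then obtain N where N: "\<And>n. n \<ge> N \<Longrightarrow> \<bar>t\<bar> * r ^ Suc n < 1/2"
    by (auto simp: eventually_sequentially)
  show ?thesis
  proof (rule summable_ratio_test[of "1/2" N])
    fix n assume "n \<ge> N"
    have "norm (t ^ Suc n * r ^ (Suc (Suc n) choose 2))
        = (\<bar>t\<bar> * r ^ Suc n) * norm (t ^ n * r ^ (Suc n choose 2))"
      using assms(1) by (simp add: numeral_2_eq_2 power_add abs_mult power_abs)
    also have "\<dots> \<le> 1/2 * norm (t ^ n * r ^ (Suc n choose 2))"
      using N[OF \<open>n \<ge> N\<close>] by (intro mult_right_mono) auto
    finally show "norm (t ^ Suc n * r ^ (Suc (Suc n) choose 2))
        \<le> 1/2 * norm (t ^ n * r ^ (Suc n choose 2))" .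
  qed simp
qed

lemma tri_of_nat: "tri (int n) = int (Suc n choose 2)"
  using two_tri[of "int n"] two_choose_two[of "Suc n"] by (simp add: algebra_simps)

lemma tri_neg: "tri (- int (Suc n)) = int (Suc n choose 2)"
  using two_tri[of "- int (Suc n)"] two_choose_two[of "Suc n"] by (simp add: algebra_simps)

text \<open>Both halves of the bilateral series are of the type of \<open>summable_half_theta\<close>: triangular
  numbers satisfy \<open>tri (- (n + 1)) = tri n\<close>, so the negative half is the nonnegative one
  with \<open>z\<close> replaced by \<open>1 / z\<close>, up to a factor.\<close>

lemma theta_term_abs_summable:
  assumes "norm q < 1"
  shows "(\<lambda>n. norm (theta_term q z n)) summable_on UNIV"
proof -
  have "(\<lambda>n. norm (theta_term q z (int n))) summable_on UNIV"
    unfolding theta_term_def using assms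
    by (subst summable_on_UNIV_nonneg_real_iff)
      (simp_all add: tri_of_nat norm_mult norm_power summable_half_theta)
  then have "(\<lambda>n. norm (theta_term q z n)) summable_on range int"
    by (simp add: summable_on_reindex o_def)
  moreover have "(\<lambda>n. norm (theta_term q z (- int (Suc n)))) summable_on UNIV"
  proof -
    have "norm (theta_term q z (- int (Suc n)))
        = inverse (norm z) * (inverse (norm z) ^ n * norm q ^ (Suc n choose 2))" for n
      unfolding theta_term_def tri_neg power_int_minus
      by (simp add: norm_mult norm_power norm_inverse power_inverse del: of_nat_Suc)
    then show ?thesis
      using assms by (subst summable_on_UNIV_nonneg_real_iff)
        (simp_all add: summable_half_theta summable_mult del: of_nat_Suc)
  qed
  then have "(\<lambda>n. norm (theta_term q z n)) summable_on range (\<lambda>n. - int (Suc n))"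
    by (subst summable_on_reindex) (auto simp: o_def inj_on_def)
  ultimately have "(\<lambda>n. norm (theta_term q z n)) summable_on (range int \<union> range (\<lambda>n. - int (Suc n)))"
    by (rule summable_on_union)
  also have "range int \<union> range (\<lambda>n. - int (Suc n)) = UNIV"
  proof -
    have "n \<in> range int \<union> range (\<lambda>n. - int (Suc n))" for n
      by (cases n rule: int_cases) auto
    then show ?thesis by blast
  qed
  finally show ?thesis .
qed

text \<open>Tannery's theorem for unordered sums. The bound makes the partial sums over finite sets converge
  uniformly in \<open>N\<close> (Weierstrass' test), so the two limits may be interchanged.\<close>

lemma tannery_infsum:
  fixes f :: "nat \<Rightarrow> 'a \<Rightarrow> 'b :: banach"
  assumes "\<And>N x. x \<in> X \<Longrightarrow> norm (f N x) \<le> M x"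
    and "M summable_on X"
    and "\<And>x. x \<in> X \<Longrightarrow> (\<lambda>N. f N x) \<longlonglongrightarrow> g x"
  shows "(\<lambda>N. \<Sum>\<^sub>\<infinity>x\<in>X. f N x) \<longlonglongrightarrow> (\<Sum>\<^sub>\<infinity>x\<in>X. g x)"
proof (rule swap_uniform_limit')
  show "\<forall>\<^sub>F A in finite_subsets_at_top X. (\<lambda>N. \<Sum>x\<in>A. f N x) \<longlonglongrightarrow> (\<Sum>x\<in>A. g x)"
    using assms(3) by (intro eventually_finite_subsets_at_top_weakI tendsto_sum) auto
  have "norm (g x) \<le> M x" if "x \<in> X" for x
    using assms(1)[OF that] by (intro LIMSEQ_le_const2[OF tendsto_norm[OF assms(3)[OF that]]]) auto
  then have "(\<lambda>x. norm (g x)) summable_on X"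
    by (intro summable_on_comparison_test[OF assms(2)]) auto
  then have "g summable_on X"
    by (rule abs_summable_summable)
  then show "(sum g \<longlongrightarrow> infsum g X) (finite_subsets_at_top X)"
    using has_sum_infsum unfolding has_sum_def by blast
  show "uniform_limit UNIV (\<lambda>A N. \<Sum>x\<in>A. f N x) (\<lambda>N. \<Sum>\<^sub>\<infinity>x\<in>X. f N x) (finite_subsets_at_top X)"
    by (rule Weierstrass_m_test_general) (use assms in auto)
qed auto

section \<open>The triple product\<close>

text \<open>Each factor of the product has the form \<open>1 - z q^(- i)\<close> with \<open>i < N\<close>. Pulling out \<open>- z q^(- i)\<close>
  leaves \<open>1 - q^i / z\<close>, and the factors pulled out multiply to the inverse of the theta weight
  at \<open>- N\<close>.\<close>

lemma theta_term_mult_qprod: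
  assumes "q \<noteq> 0" "z \<noteq> 0"
  shows "theta_term q z (- int N) * qprod q (z * q powi (1 - int N)) N = qprod q (1 / z) N"
proof (induction N)
  case (Suc N)
  have "tri (- int (Suc N)) = tri (- int N) + int N"
    using two_tri[of "- int (Suc N)"] two_tri[of "- int N"] by (simp add: algebra_simps)
  then have "q powi tri (- int (Suc N)) = q powi tri (- int N) * q ^ N"
    using assms by (simp add: power_int_add)
  moreover have "(- z) powi (- int N - 1) = - ((- z) powi (- int N) / z)"
    using assms by (simp add: power_int_diff)
  then have "(- z) powi (- int (Suc N)) = - ((- z) powi (- int N) / z)"
    by (simp only: of_nat_Suc minus_add_distrib uminus_add_conv_diff minus_diff_commute)
  ultimately have 1: "theta_term q z (- int (Suc N)) = - (theta_term q z (- int N) * q ^ N / z)"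
    by (simp add: theta_term_def del: of_nat_Suc)
  have "q powi (1 - int N) = q * q powi (- int N)"
    using assms by (simp add: power_int_diff power_int_minus field_simps)
  then have 2: "qprod q (z * q powi (1 - int (Suc N))) (Suc N)
      = (1 - z * q powi (- int N)) * qprod q (z * q powi (1 - int N)) N"
    using qprod_add[of q "z * q powi (- int N)" 1 N] by (simp add: qprod_def mult_ac)
  have 3: "- (q ^ N / z) * (1 - z * q powi (- int N)) = 1 - 1 / z * q ^ N"
    using assms by (simp add: power_int_minus field_simps)
  have "theta_term q z (- int (Suc N)) * qprod q (z * q powi (1 - int (Suc N))) (Suc N)
      = (- (q ^ N / z) * (1 - z * q powi (- int N)))
        * (theta_term q z (- int N) * qprod q (z * q powi (1 - int N)) N)"
    unfolding 1 2 by simp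
  also have "\<dots> = qprod q (1 / z) (Suc N)"
    unfolding 3 Suc.IH by (simp add: qprod_Suc)
  finally show ?case .
qed (simp add: theta_term_def tri_def)

text \<open>This is the \<open>q\<close>-binomial theorem for a product of \<open>2 N\<close> factors \<open>1 - w q^j\<close> that starts at
  \<open>w = z q^(1 - N)\<close>: its first half consists of the nonpositive powers of \<open>q\<close> and becomes the
  product in \<open>1 / z\<close>, its second half is the product in \<open>z q\<close>.\<close>

lemma finite_triple_product:
  assumes "q \<noteq> 0" "z \<noteq> 0"
  shows "(\<Sum>l\<le>2 * N. qbinom q (2 * N) l * theta_term q z (int l - int N))
    = qprod q (1 / z) N * qprod q (z * q) N"
proof -
  define w where "w = z * q powi (1 - int N)"
  have w: "q ^ N * w = z * q"
    using assms by (simp add: w_def power_int_diff field_simps)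
  have "theta_term q z (int l - int N)
      = theta_term q z (- int N) * (q ^ (l choose 2) * (- w) ^ l)" for l
    using theta_term_shift[OF assms, of "- int N" l z] assms
    by (simp add: w_def add.commute)
  then have "(\<Sum>l\<le>2 * N. qbinom q (2 * N) l * theta_term q z (int l - int N))
      = theta_term q z (- int N) * qprod q w (2 * N)"
    by (simp add: q_binomial_theorem sum_distrib_left mult_ac)
  also have "\<dots> = theta_term q z (- int N) * qprod q w N * qprod q (z * q) N"
    using qprod_add[of q w N N] by (simp add: w mult_2)
  also have "theta_term q z (- int N) * qprod q w N = qprod q (1 / z) N"
    unfolding w_def by (rule theta_term_mult_qprod[OF assms])
  finally show ?thesis .
qed

text \<open>After multiplication by \<open>(q; q)_N\<close> the coefficients of the finite identity are
  \<open>(q)_N (q)_2N / ((q)_(N+n) (q)_(N-n))\<close>. They are bounded uniformly in \<open>N\<close> and \<open>n\<close> and tend to \<open>1\<close>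
  for each \<open>n\<close>, because \<open>(q; q)_N\<close> is never zero and tends to a nonzero limit. So Tannery's theorem applies with
  a multiple of the absolutely summable theta series as majorant.\<close>

theorem jacobi_triple_product:
  assumes "norm q < 1" "q \<noteq> 0" "z \<noteq> 0"
  shows "(\<Sum>\<^sub>\<infinity>n. theta_term q z n) = qpoch_inf q q * (qpoch_inf q (1 / z) * qpoch_inf q (z * q))"
proof -
  define F where "F = qprod q q"
  define L where "L = qpoch_inf q q"
  have F: "F \<longlonglongrightarrow> L"
    unfolding F_def L_def by (rule qprod_tendsto_qpoch_inf) fact
  have F0: "F n \<noteq> 0" for n
    by (simp add: F_def qprod_q_nonzero assms)
  have L0: "L \<noteq> 0"
    unfolding L_def using assms by (intro qpoch_inf_nonzero q_power_neq_1)
  obtain B where B: "norm (F n) \<le> B" for n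
    using convergent_imp_Bseq[OF convergentI[OF F]] unfolding Bseq_def by blast
  obtain C where C: "norm (inverse (F n)) \<le> C" for n
    using convergent_imp_Bseq[OF convergentI[OF tendsto_inverse[OF F L0]]] unfolding Bseq_def by blast
  have B0: "0 \<le> B" and C0: "0 \<le> C"
    using B[of 0] C[of 0] norm_ge_zero order_trans by blast+
  \<comment> \<open>Cut off outside \<open>\<bar>n\<bar> \<le> N\<close>, so that the finite identities become sums over all integers.\<close>
  define c where "c N n = (if \<bar>n\<bar> \<le> int N then F N * qbinom q (2 * N) (nat (n + int N)) else 0)" for N n
  have c: "c N n = F N * (F (2 * N) * (inverse (F (nat (int N + n))) * inverse (F (nat (int N - n)))))"
    if "\<bar>n\<bar> \<le> int N" for N n
  proof -
    have "2 * N - nat (n + int N) = nat (int N - n)" "nat (n + int N) \<le> 2 * N"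
      using that by auto
    then show ?thesis
      using qbinom_mult_qprod[of "nat (n + int N)" "2 * N" q] that F0
      by (simp add: c_def F_def field_simps)
  qed
  have bound: "norm (c N n * theta_term q z n) \<le> B * (B * (C * C)) * norm (theta_term q z n)" for N n
  proof -
    have "norm (c N n) \<le> B * (B * (C * C))"
    proof (cases "\<bar>n\<bar> \<le> int N")
      case True
      then show ?thesis
        unfolding c[OF True] norm_mult using B C B0 C0 by (intro mult_mono) auto
    next
      case False
      then show ?thesis using B0 C0 by (simp add: c_def)
    qed
    then show ?thesis
      by (simp add: norm_mult mult_right_mono)
  qed
  have c_lim: "(\<lambda>N. c N n) \<longlonglongrightarrow> 1" for n
  proof -
    have sub: "(\<lambda>N. F (nat (int N + m))) \<longlonglongrightarrow> L" for m
    proof (rule filterlim_compose[OF F])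
      show "filterlim (\<lambda>N. nat (int N + m)) sequentially sequentially"
        unfolding filterlim_at_top
      proof
        fix Z
        show "\<forall>\<^sub>F N in sequentially. Z \<le> nat (int N + m)"
          using eventually_ge_at_top[of "Z + nat \<bar>m\<bar>"] by eventually_elim linarith
      qed
    qed
    have "(\<lambda>N. F (2 * N)) \<longlonglongrightarrow> L"
      by (rule filterlim_compose[OF F]) (auto intro!: filterlim_subseq simp: strict_mono_def)
    then have "(\<lambda>N. F N * (F (2 * N) * (inverse (F (nat (int N + n))) * inverse (F (nat (int N - n))))))
        \<longlonglongrightarrow> L * (L * (inverse L * inverse L))"
      using sub[of n] sub[of "- n"] L0 by (intro tendsto_intros F) auto
    also have "L * (L * (inverse L * inverse L)) = 1"
      using L0 by (simp add: field_simps)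
    finally show ?thesis
    proof (rule Lim_transform_eventually)
      show "\<forall>\<^sub>F N in sequentially.
          F N * (F (2 * N) * (inverse (F (nat (int N + n))) * inverse (F (nat (int N - n))))) = c N n"
        using eventually_ge_at_top[of "nat \<bar>n\<bar>"] by eventually_elim (simp add: c)
    qed
  qed
  have "(\<lambda>N. \<Sum>\<^sub>\<infinity>n. c N n * theta_term q z n) \<longlonglongrightarrow> (\<Sum>\<^sub>\<infinity>n. 1 * theta_term q z n)"
  proof (rule tannery_infsum[OF bound])
    show "(\<lambda>N. c N n * theta_term q z n) \<longlonglongrightarrow> 1 * theta_term q z n" for n
      by (intro tendsto_intros c_lim)
  qed (intro summable_on_cmult_right theta_term_abs_summable assms)
  moreover have "(\<Sum>\<^sub>\<infinity>n. c N n * theta_term q z n) = F N * (qprod q (1 / z) N * qprod q (z * q) N)" for N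
  proof -
    have "(\<Sum>\<^sub>\<infinity>n. c N n * theta_term q z n) = (\<Sum>n\<in>{- int N..int N}. c N n * theta_term q z n)"
      by (subst infsum_cong_neutral[where T = "{- int N..int N}"]) (auto simp: c_def)
    also have "\<dots> = (\<Sum>l\<le>2 * N. c N (int l - int N) * theta_term q z (int l - int N))"
      by (rule sum.reindex_bij_witness[of _ "\<lambda>l. int l - int N" "\<lambda>n. nat (n + int N)"]) auto
    also have "\<dots> = F N * (\<Sum>l\<le>2 * N. qbinom q (2 * N) l * theta_term q z (int l - int N))"
      unfolding sum_distrib_left by (intro sum.cong refl) (auto simp: c_def)
    finally show ?thesis
      by (simp add: finite_triple_product assms)
  qed
  ultimately have "(\<lambda>N. F N * (qprod q (1 / z) N * qprod q (z * q) N)) \<longlonglongrightarrow> (\<Sum>\<^sub>\<infinity>n. theta_term q z n)"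
    by simp
  moreover have "(\<lambda>N. F N * (qprod q (1 / z) N * qprod q (z * q) N))
      \<longlonglongrightarrow> L * (qpoch_inf q (1 / z) * qpoch_inf q (z * q))"
    by (intro tendsto_intros F qprod_tendsto_qpoch_inf assms)
  ultimately show ?thesis
    unfolding L_def by (rule LIMSEQ_unique)
qed

lemma theta_series_nonzero:
  assumes "norm q < 1" "q \<noteq> 0" "z \<noteq> 0" and "\<And>m. z * q powi m \<noteq> 1"
  shows "(\<Sum>\<^sub>\<infinity>n. theta_term q z n) \<noteq> 0"
proof -
  have "1 / z * q ^ j \<noteq> 1" for j
    using assms(4)[of "- int j"] assms by (simp add: power_int_minus field_simps)
  moreover have "z * q * q ^ j \<noteq> 1" for j
    using assms(4)[of "int (Suc j)"] by (simp del: of_nat_Suc add: power_int_of_nat mult.assoc)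
  ultimately show ?thesis
    using assms by (simp add: jacobi_triple_product qpoch_inf_nonzero q_power_neq_1 del: mult_eq_1_iff)
qed

section \<open>The terminating bilateral series\<close>

lemma has_sum_finite_sum:
  fixes f :: "'i \<Rightarrow> 'a \<Rightarrow> complex"
  assumes "finite I" and "\<And>i. i \<in> I \<Longrightarrow> (f i has_sum S i) A"
  shows "((\<lambda>x. \<Sum>i\<in>I. f i x) has_sum (\<Sum>i\<in>I. S i)) A"
  using assms by (induction I rule: finite_induct) (auto intro!: has_sum_add)

text \<open>Expanding by the \<open>q\<close>-binomial theorem turns the series into a finite combination of index
  shifts of the theta series, and a shift does not change a sum over all integers.\<close>

lemma infsum_theta_term_qprod:
  assumes "norm q < 1" "q \<noteq> 0" "z \<noteq> 0"
  shows "(\<Sum>\<^sub>\<infinity>n. theta_term q z n * qprod q (x * q powi (n + 1)) k)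
    = (\<Sum>\<^sub>\<infinity>n. theta_term q z n) * (\<Sum>l\<le>k. qbinom q k l * (x / z) ^ l)"
proof -
  have summable: "theta_term q z summable_on UNIV"
    by (rule abs_summable_summable) (rule theta_term_abs_summable, fact)
  have shift: "((\<lambda>n. theta_term q z (n + int l)) has_sum (\<Sum>\<^sub>\<infinity>n. theta_term q z n)) UNIV" for l
    using has_sum_infsum[OF summable]
    by (subst has_sum_reindex_bij_witness[of UNIV "\<lambda>n. n - int l" "\<lambda>n. n + int l"]) auto
  have "theta_term q z n * qprod q (x * q powi (n + 1)) k
      = (\<Sum>l\<le>k. qbinom q k l * (x / z) ^ l * theta_term q z (n + int l))" for n
    unfolding q_binomial_theorem sum_distrib_left
    using theta_term_shift[OF assms(2,3), of n _ x] by (intro sum.cong refl) (simp add: mult_ac)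
  moreover have "((\<lambda>n. \<Sum>l\<le>k. qbinom q k l * (x / z) ^ l * theta_term q z (n + int l)) has_sum
      (\<Sum>l\<le>k. qbinom q k l * (x / z) ^ l * (\<Sum>\<^sub>\<infinity>n. theta_term q z n))) UNIV"
    by (intro has_sum_finite_sum has_sum_cmult_right shift finite_atMost)
  ultimately show ?thesis
    by (simp add: infsumI sum_distrib_left mult_ac)
qed

section \<open>Exponential parametrization\<close>

lemma norm_nome:
  assumes "Im \<tau> > 0"
  shows "norm (exp (2 * of_real pi * \<i> * \<tau>)) < 1"
  using assms by (simp add: norm_exp_eq_Re)

text \<open>The infinite products in the denominators of the series, and those in the triple product for
  \<open>theta11\<close>, can vanish only under an equation of this form. The two lattice hypotheses on
  \<open>u\<close> and \<open>v\<close> enter only through this criterion.\<close>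

lemma exp_mult_nome_eq_1_imp_lattice:
  assumes "exp (2 * of_real pi * \<i> * u) * exp (2 * of_real pi * \<i> * \<tau>) powi m = 1"
  shows "u \<in> period_lattice \<tau>"
proof -
  have "exp (2 * of_real pi * \<i> * (u + of_int m * \<tau>)) = 1"
    using assms by (simp add: exp_power_int exp_add[symmetric] algebra_simps)
  then obtain n where "2 * of_real pi * \<i> * (u + of_int m * \<tau>) = of_int (2 * n) * of_real pi * \<i>"
    unfolding exp_eq_1 by (auto simp: complex_eq_iff)
  then have "2 * of_real pi * \<i> * (u + of_int m * \<tau>) = 2 * of_real pi * \<i> * of_int n"
    by (simp add: mult_ac)
  then have "u + of_int m * \<tau> = of_int n"
    by (subst (asm) mult_cancel_left) simp
  then have "u = of_int n + of_int (- m) * \<tau>"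
    by (simp add: algebra_simps)
  then show ?thesis
    unfolding period_lattice_def by blast
qed

lemma of_int_tri: "of_int n * (of_int n + 1) / 2 = (of_int (tri n) :: complex)"
proof -
  have "of_int (2 * tri n) = (of_int n * (of_int n + 1) :: complex)"
    unfolding two_tri by simp
  then show ?thesis by (simp add: field_simps)
qed

lemma qpow_of_int: "qpow \<tau> (of_int m) = exp (2 * of_real pi * \<i> * \<tau>) powi m"
  by (simp add: qpow_def exp_power_int mult_ac)

lemma theta_term_exp:
  "exp (of_real pi * \<i> * v) * theta_term (exp (2 * of_real pi * \<i> * \<tau>)) (exp (2 * of_real pi * \<i> * v)) n
    = (-1) powi n * exp (2 * of_real pi * \<i> * (of_int n + 1/2) * v)
        * qpow \<tau> (of_int n * (of_int n + 1) / 2)"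
proof -
  have "(- exp (2 * of_real pi * \<i> * v)) powi n
      = (-1) powi n * exp (2 * of_real pi * \<i> * v) powi n"
    by (metis mult_minus1 power_int_mult_distrib)
  moreover have "exp (2 * of_real pi * \<i> * (of_int n + 1/2) * v)
      = exp (of_real pi * \<i> * v) * exp (2 * of_real pi * \<i> * v) powi n"
    by (simp add: exp_power_int exp_add[symmetric] algebra_simps)
  ultimately show ?thesis
    by (simp add: theta_term_def of_int_tri qpow_of_int)
qed

lemma theta11_eq:
  "theta11 \<tau> v = \<i> * qpow \<tau> (1/8) * exp (of_real pi * \<i> * v)
    * (\<Sum>\<^sub>\<infinity>n. theta_term (exp (2 * of_real pi * \<i> * \<tau>)) (exp (2 * of_real pi * \<i> * v)) n)"
proof -
  have "exp (2 * of_real pi * \<i> * (of_int n + 1/2) * (v + 1/2)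
          + of_real pi * \<i> * (of_int n + 1/2)\<^sup>2 * \<tau>)
      = \<i> * qpow \<tau> (1/8) * (exp (of_real pi * \<i> * v)
        * theta_term (exp (2 * of_real pi * \<i> * \<tau>)) (exp (2 * of_real pi * \<i> * v)) n)" for n :: int
  proof -
    \<comment> \<open>The shift of \<open>v\<close> by \<open>1/2\<close> yields \<open>\<i>\<close> and the sign; completing the square,
      \<open>(n + 1/2)^2 = n (n + 1) + 1/4\<close>, yields \<open>qpow \<tau> (1/8)\<close>.\<close>
    have "2 * of_real pi * \<i> * (of_int n + 1/2) * (v + 1/2)
          + of_real pi * \<i> * (of_int n + 1/2)\<^sup>2 * \<tau>
      = of_real pi / 2 * \<i> + 2 * of_real pi * \<i> * (1/8) * \<tau>
        + (of_int n * (of_real pi * \<i>) + 2 * of_real pi * \<i> * (of_int n + 1/2) * v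
        + 2 * of_real pi * \<i> * (of_int n * (of_int n + 1) / 2) * \<tau>)"
      by (simp add: power2_eq_square field_simps)
    moreover have "exp (of_real pi / 2 * \<i>) = \<i>"
      using exp_Euler[of "of_real pi / 2"] by (metis cis_conv_exp cis_pi_half mult.commute of_real_divide of_real_numeral)
    moreover have "exp (of_int n * (of_real pi * \<i>)) = (-1) powi n"
      by (metis exp_power_int exp_pi_i)
    ultimately show ?thesis
      unfolding theta_term_exp by (simp add: exp_add qpow_def)
  qed
  then show ?thesis
    unfolding theta11_def by (simp add: infsum_cmult_right' mult_ac)
qed

lemma theta11_nonzero:
  assumes "Im \<tau> > 0" "v \<notin> period_lattice \<tau>"
  shows "theta11 \<tau> v \<noteq> 0"
proof -
  have "(\<Sum>\<^sub>\<infinity>n. theta_term (exp (2 * of_real pi * \<i> * \<tau>)) (exp (2 * of_real pi * \<i> * v)) n) \<noteq> 0"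
    using exp_mult_nome_eq_1_imp_lattice assms(2)
    by (intro theta_series_nonzero norm_nome assms(1)) auto
  then show ?thesis
    by (simp add: theta11_eq qpow_def)
qed

lemma poly_qhermite: "poly (qhermite q k) (cos \<theta>) = qhermite_sum q k \<theta>"
  using theI'[OF qhermite_ex1[of q k]] unfolding qhermite_def by blast

text \<open>The hypothesis on \<open>u\<close> keeps the denominators of the ratios of infinite products away from
  zero, and the one on \<open>v\<close> makes it possible to cancel the theta series.\<close>

lemma gen_mu_neg_nat:
  assumes "Im \<tau> > 0" "u \<notin> period_lattice \<tau>" "v \<notin> period_lattice \<tau>"
  defines "q \<equiv> exp (2 * of_real pi * \<i> * \<tau>)"
  shows "gen_mu \<tau> u v (- of_nat k) = - \<i> * qpow \<tau> (- 1/8) * (exp (- (of_real pi * \<i> * of_nat k * (u - v)))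
    * (\<Sum>l\<le>k. qbinom q k l * exp (2 * of_real pi * \<i> * (u - v)) ^ l))"
proof -
  define x where "x = exp (2 * of_real pi * \<i> * u)"
  define z where "z = exp (2 * of_real pi * \<i> * v)"
  define S where "S = (\<Sum>\<^sub>\<infinity>n. theta_term q z n)"
  have q: "norm q < 1" "q \<noteq> 0" and z: "z \<noteq> 0" and qpow1: "qpow \<tau> 1 = q"
    using norm_nome[OF assms(1)] by (simp_all add: q_def z_def qpow_def)
  \<comment> \<open>The denominator is the tail of the numerator after its first \<open>k\<close> factors.\<close>
  have ratio: "qpoch_inf q (x * qpow \<tau> (of_int n + 1)) / qpoch_inf q (x * qpow \<tau> (of_int n - (- of_nat k) + 1))
      = qprod q (x * q powi (n + 1)) k" for n
  proof -
    have 1: "qpow \<tau> (of_int n + 1) = q powi (n + 1)"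
      using qpow_of_int[of \<tau> "n + 1"] by (simp add: q_def)
    have 2: "qpow \<tau> (of_int n - (- of_nat k) + 1) = q ^ k * q powi (n + 1)"
    proof -
      have "of_int n - (- of_nat k) + 1 = (of_int (int k + (n + 1)) :: complex)"
        by simp
      then show ?thesis
        using q by (simp only: qpow_of_int q_def[symmetric]) (simp add: power_int_add)
    qed
    have "x * (q ^ k * q powi (n + 1)) * q ^ j \<noteq> 1" for j
    proof -
      have "x * (q ^ k * q powi (n + 1)) * q ^ j = x * q powi (int (k + j) + (n + 1))"
        using q by (simp add: power_int_add power_add)
      then show ?thesis
        using exp_mult_nome_eq_1_imp_lattice[of u \<tau>] assms(2) by (metis q_def x_def)
    qed
    then have "qpoch_inf q (q ^ k * (x * q powi (n + 1))) \<noteq> 0"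
      by (intro qpoch_inf_nonzero q) (simp add: mult_ac)
    then show ?thesis
      unfolding 1 2 qpoch_inf_split[OF q(1), of "x * q powi (n + 1)" k] by (simp add: mult_ac)
  qed
  have "gen_mu \<tau> u v (- of_nat k) = exp (of_real pi * \<i> * (- of_nat k) * (u - v)) / theta11 \<tau> v
      * (\<Sum>\<^sub>\<infinity>n. exp (of_real pi * \<i> * v) * (theta_term q z n * qprod q (x * q powi (n + 1)) k))"
    unfolding gen_mu_def theta_term_exp[symmetric] qpow1 x_def[symmetric] z_def[symmetric] q_def[symmetric] ratio
    by (simp add: mult_ac)
  also have "\<dots> = exp (- (of_real pi * \<i> * of_nat k * (u - v))) / theta11 \<tau> v
      * (exp (of_real pi * \<i> * v) * S * (\<Sum>l\<le>k. qbinom q k l * (x / z) ^ l))"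
    unfolding S_def infsum_cmult_right' infsum_theta_term_qprod[OF q z] by (simp add: mult_ac)
  also have "theta11 \<tau> v = \<i> * qpow \<tau> (1/8) * (exp (of_real pi * \<i> * v) * S)"
    by (simp add: theta11_eq S_def q_def z_def)
  also have "x / z = exp (2 * of_real pi * \<i> * (u - v))"
    by (simp add: x_def z_def exp_diff[symmetric] algebra_simps)
  finally have mu: "gen_mu \<tau> u v (- of_nat k) = exp (- (of_real pi * \<i> * of_nat k * (u - v)))
      / (\<i> * qpow \<tau> (1/8) * (exp (of_real pi * \<i> * v) * S))
      * (exp (of_real pi * \<i> * v) * S * (\<Sum>l\<le>k. qbinom q k l * exp (2 * of_real pi * \<i> * (u - v)) ^ l))" .
  have "S \<noteq> 0"
    using theta11_nonzero[OF assms(1,3)] by (auto simp: theta11_eq S_def q_def z_def)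
  moreover have "qpow \<tau> (- 1/8) = 1 / qpow \<tau> (1/8)" "qpow \<tau> (1/8) \<noteq> 0"
    by (simp_all add: qpow_def exp_minus field_simps)
  ultimately show ?thesis
    unfolding mu by (simp add: field_simps)
qed

theorem theorem1p6:
  fixes \<tau> q u v :: complex and k :: nat
  assumes "Im \<tau> > 0"
    and "q = exp (2 * of_real pi * \<i> * \<tau>)"
    and "u \<notin> period_lattice \<tau>"
    and "v \<notin> period_lattice \<tau>"
  shows "gen_mu \<tau> u v (- of_nat k) =
           - \<i> * qpow \<tau> (- 1/8) * poly (qhermite q k) (cos (of_real pi * (u - v)))
       \<and> poly (qhermite q k) (cos (of_real pi * (u - v))) =
           (\<Sum>l=0..k. qpoch q q k / (qpoch q q l * qpoch q q (k - l))
                      * exp (of_real pi * \<i> * (of_nat k - 2 * of_nat l) * (u - v)))"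
proof
  have q: "norm q < 1"
    using norm_nome[OF assms(1)] assms(2) by simp
  show H: "poly (qhermite q k) (cos (of_real pi * (u - v))) =
           (\<Sum>l=0..k. qpoch q q k / (qpoch q q l * qpoch q q (k - l))
                      * exp (of_real pi * \<i> * (of_nat k - 2 * of_nat l) * (u - v)))"
    unfolding poly_qhermite qhermite_sum_def by (simp add: mult_ac)
  \<comment> \<open>The exponents come out as \<open>2 l - k\<close> instead of \<open>k - 2 l\<close>, so the sum is reversed.\<close>
  have "exp (- (of_real pi * \<i> * of_nat k * (u - v)))
        * (qbinom q k l * exp (2 * of_real pi * \<i> * (u - v)) ^ l)
      = qpoch q q k / (qpoch q q (k - l) * qpoch q q (k - (k - l)))
        * exp (of_real pi * \<i> * (of_nat k - 2 * of_nat (k - l)) * (u - v))" if "l \<le> k" for l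
  proof -
    have "exp (- (of_real pi * \<i> * of_nat k * (u - v))) * exp (2 * of_real pi * \<i> * (u - v)) ^ l
        = exp (of_real pi * \<i> * (of_nat k - 2 * of_nat (k - l)) * (u - v))"
      using that by (simp add: exp_of_nat_mult[symmetric] exp_add[symmetric] of_nat_diff algebra_simps)
    then show ?thesis
      using that q by (simp add: qbinom_eq_qpoch mult_ac)
  qed
  then have "exp (- (of_real pi * \<i> * of_nat k * (u - v)))
        * (\<Sum>l\<le>k. qbinom q k l * exp (2 * of_real pi * \<i> * (u - v)) ^ l)
      = (\<Sum>l\<le>k. qpoch q q k / (qpoch q q (k - l) * qpoch q q (k - (k - l)))
        * exp (of_real pi * \<i> * (of_nat k - 2 * of_nat (k - l)) * (u - v)))"
    unfolding sum_distrib_left by (intro sum.cong) auto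
  also have "\<dots> = poly (qhermite q k) (cos (of_real pi * (u - v)))"
    unfolding H by (rule sum.reindex_bij_witness[of _ "\<lambda>l. k - l" "\<lambda>l. k - l"]) auto
  finally show "gen_mu \<tau> u v (- of_nat k) =
           - \<i> * qpow \<tau> (- 1/8) * poly (qhermite q k) (cos (of_real pi * (u - v)))"
    using gen_mu_neg_nat[OF assms(1,3,4), of k] by (simp add: assms(2))
qed

end
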